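(* Let $\varphi_0$ be a seed function and let $\langle\!\langle\cdot,\cdot\rangle\!\rangle$ be a Hermitian sesquilinear form on $\mathrm{span}\{\varphi_0^{(n)}\}_{n\in\mathbb{Z}_+}$ such that $\langle\!\langle\varphi_0,\varphi_0\rangle\!\rangle=1$. If, in the differential Arnoldi algorithm started from $\varphi_0$, one has $D_{n+1,n}>0$ for all $n\in\mathbb{Z}_+$, then the algorithm generates a sequence $\Phi=\{\varphi_n\}_{n=0}^\infty$ and an upper Hessenberg matrix $\mathcal{D}=(D_{k,j})_{k,j\in\mathbb{Z}_+}$ such that for all $n=1,2,\ldots$: (i) $\{\varphi_0,\ldots,\varphi_n\}$ is an orthonormal basis for $\mathcal{K}_{n+1}(\varphi_0)$ with respect to $\langle\!\langle\cdot,\cdot\rangle\!\rangle$; (ii) $\varphi_{n-1}'(x)=\sum_{k=0}^n D_{k,n-1}\varphi_k(x)$.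
   Context: Functions are complex-valued and infinitely differentiable on an interval $(a,b)$ with $-\infty\le a<b\le\infty$; spans are over $\mathbb{C}$; $\mathbb{Z}_+=\{0,1,2,\ldots\}$. A Hermitian sesquilinear form is linear in the first argument, conjugate-linear in the second, and satisfies $\langle\!\langle f,g\rangle\!\rangle=\overline{\langle\!\langle g,f\rangle\!\rangle}$; it is not assumed to be positive definite or nondegenerate. Seed function: a smooth function $\varphi_0$ that is not a solution of any (nontrivial) homogeneous linear ordinary differential equation with constant coefficients. Differential Krylov space: for smooth $g$ and $n\ge1$, $\mathcal{K}_n(g)=\mathrm{span}\{g,g',\ldots,g^{(n-1)}\}$. Differential Arnoldi algorithm: for $n=0,1,2,\ldots$, set $\psi_{n+1}^{[0]}=\varphi_n'$; for $k=0,1,\ldots,n$ successively set $$D_{k,n}=\langle\!\langle\psi_{n+1}^{[k]},\varphi_k\rangle\!\rangle,\qquad \psi_{n+1}^{[k+1]}=\psi_{n+1}^{[k]}-D_{k,n}\varphi_k;$$ then set $\psi_{n+1}=\psi_{n+1}^{[n+1]}$, $D_{n+1,n}=\left|\langle\!\langle\psi_{n+1},\psi_{n+1}\rangle\!\rangle\right|^{1/2}$ and $\varphi_{n+1}=D_{n+1,n}^{-1}\psi_{n+1}$. The remaining entries are $D_{k,n}=0$ for $k>n+1$.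
   Formalization: Orthonormality in (i) is claimed for a given n only if ⟨⟨ψ_k,ψ_k⟩⟩ ≥ 0 for k=1,…,n, since for indefinite forms it can fail (⟨⟨φ_1,φ_1⟩⟩ = −1 is possible); the basis claim, (ii) and the Hessenberg property are unconditional. *)

theory Defs
  imports
    "HOL-Analysis.Analysis"
    "HOL-Library.Function_Algebras"
    "HOL-Library.Complex_Order"
begin

definition cscale :: "complex \<Rightarrow> (real \<Rightarrow> complex) \<Rightarrow> real \<Rightarrow> complex" where
  "cscale c f = (\<lambda>x. c * f x)"

interpretation cfun: vector_space cscale
  by unfold_locales (auto simp: cscale_def fun_eq_iff algebra_simps)

text \<open>
  A function on \<open>(a,b)\<close> is represented by a total function on the reals; every derivative is set
  to zero outside \<open>(a,b)\<close>.  The values of \<open>\<phi>\<^sub>0\<close> outside \<open>(a,b)\<close> are irrelevant: for a seed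
  function, two elements of the span of its derivatives that agree on \<open>(a,b)\<close> are equal, because
  a linear combination of derivatives vanishing on \<open>(a,b)\<close> has only zero coefficients.
\<close>

definition deriv_on :: "ereal \<Rightarrow> ereal \<Rightarrow> (real \<Rightarrow> complex) \<Rightarrow> real \<Rightarrow> complex" where
  "deriv_on a b f =
     (\<lambda>x. if x \<in> einterval a b then vector_derivative f (at x) else 0)"

definition nth_deriv_on :: "ereal \<Rightarrow> ereal \<Rightarrow> nat \<Rightarrow> (real \<Rightarrow> complex) \<Rightarrow> real \<Rightarrow> complex" where
  "nth_deriv_on a b n f = (deriv_on a b ^^ n) f"

definition smooth_on_interval :: "ereal \<Rightarrow> ereal \<Rightarrow> (real \<Rightarrow> complex) \<Rightarrow> bool" where
  "smooth_on_interval a b f \<longleftrightarrow>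
     (\<forall>n. \<forall>x\<in>einterval a b. nth_deriv_on a b n f differentiable (at x))"

definition seed_function :: "ereal \<Rightarrow> ereal \<Rightarrow> (real \<Rightarrow> complex) \<Rightarrow> bool" where
  "seed_function a b f \<longleftrightarrow> smooth_on_interval a b f \<and>
     \<not> (\<exists>(m::nat) (c::nat \<Rightarrow> complex). (\<exists>k\<le>m. c k \<noteq> 0) \<and>
          (\<forall>x\<in>einterval a b. (\<Sum>k\<le>m. c k * nth_deriv_on a b k f x) = 0))"

definition deriv_span :: "ereal \<Rightarrow> ereal \<Rightarrow> (real \<Rightarrow> complex) \<Rightarrow> (real \<Rightarrow> complex) set" where
  "deriv_span a b f = cfun.span (range (\<lambda>n. nth_deriv_on a b n f))"

definition krylov :: "ereal \<Rightarrow> ereal \<Rightarrow> nat \<Rightarrow> (real \<Rightarrow> complex) \<Rightarrow> (real \<Rightarrow> complex) set" where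
  "krylov a b n g = cfun.span ((\<lambda>k. nth_deriv_on a b k g) ` {..<n})"

type_synonym form = "(real \<Rightarrow> complex) \<Rightarrow> (real \<Rightarrow> complex) \<Rightarrow> complex"

definition hermitian_form_on :: "(real \<Rightarrow> complex) set \<Rightarrow> form \<Rightarrow> bool" where
  "hermitian_form_on V B \<longleftrightarrow>
     (\<forall>f\<in>V. \<forall>g\<in>V. \<forall>h\<in>V. B (f + g) h = B f h + B g h) \<and>
     (\<forall>c. \<forall>f\<in>V. \<forall>g\<in>V. B (cscale c f) g = c * B f g) \<and>
     (\<forall>f\<in>V. \<forall>g\<in>V. \<forall>h\<in>V. B f (g + h) = B f g + B f h) \<and>
     (\<forall>c. \<forall>f\<in>V. \<forall>g\<in>V. B f (cscale c g) = cnj c * B f g) \<and>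
     (\<forall>f\<in>V. \<forall>g\<in>V. B f g = cnj (B g f))"

text \<open>
  \<open>arnoldi_step a b B f n k\<close> is \<open>\<psi>\<close> with subscript \<open>n + 1\<close> and superscript \<open>[k]\<close>, for
  \<open>k \<le> n + 1\<close>; the algorithm does not use larger \<open>k\<close>, and the guard \<open>k \<le> n\<close> only makes the
  recursion well-founded.  \<open>arnoldi_phi a b B f n\<close> is \<open>\<phi>\<^sub>n\<close>.
\<close>

function arnoldi_phi :: "ereal \<Rightarrow> ereal \<Rightarrow> form \<Rightarrow> (real \<Rightarrow> complex) \<Rightarrow> nat \<Rightarrow> real \<Rightarrow> complex"
  and arnoldi_step :: "ereal \<Rightarrow> ereal \<Rightarrow> form \<Rightarrow> (real \<Rightarrow> complex) \<Rightarrow> nat \<Rightarrow> nat \<Rightarrow> real \<Rightarrow> complex"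
where
  "arnoldi_phi a b B f 0 = f"
| "arnoldi_phi a b B f (Suc n) =
     (let p = arnoldi_step a b B f n (Suc n)
      in cscale (inverse (of_real (sqrt (cmod (B p p))))) p)"
| "arnoldi_step a b B f n 0 = deriv_on a b (arnoldi_phi a b B f n)"
| "arnoldi_step a b B f n (Suc k) =
     (if k \<le> n then
        (let p = arnoldi_step a b B f n k; q = arnoldi_phi a b B f k
         in p - cscale (B p q) q)
      else 0)"
  by pat_completeness auto
termination
  by (relation "inv_image (less_than <*lex*> less_than)
        (case_sum (\<lambda>(a, b, B, f, n). (n, 0)) (\<lambda>(a, b, B, f, n, k). (n, Suc k)))") auto

text \<open>\<open>\<psi>\<^sub>n\<close>, meaningful for \<open>n \<ge> 1\<close>.\<close>

definition arnoldi_psi :: "ereal \<Rightarrow> ereal \<Rightarrow> form \<Rightarrow> (real \<Rightarrow> complex) \<Rightarrow> nat \<Rightarrow> real \<Rightarrow> complex" where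
  "arnoldi_psi a b B f n = arnoldi_step a b B f (n - 1) n"

definition arnoldi_D :: "ereal \<Rightarrow> ereal \<Rightarrow> form \<Rightarrow> (real \<Rightarrow> complex) \<Rightarrow> nat \<Rightarrow> nat \<Rightarrow> complex" where
  "arnoldi_D a b B f k n =
     (if k \<le> n then B (arnoldi_step a b B f n k) (arnoldi_phi a b B f k)
      else if k = n + 1 then
        of_real (sqrt (cmod (B (arnoldi_psi a b B f k) (arnoldi_psi a b B f k))))
      else 0)"

definition upper_hessenberg :: "(nat \<Rightarrow> nat \<Rightarrow> complex) \<Rightarrow> bool" where
  "upper_hessenberg M \<longleftrightarrow> (\<forall>k j. k > j + 1 \<longrightarrow> M k j = 0)"

definition basis_upto :: "(nat \<Rightarrow> real \<Rightarrow> complex) \<Rightarrow> nat \<Rightarrow> (real \<Rightarrow> complex) set \<Rightarrow> bool" where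
  "basis_upto u n V \<longleftrightarrow>
     inj_on u {..n} \<and> cfun.independent (u ` {..n}) \<and> cfun.span (u ` {..n}) = V"

text \<open>
  For an indefinite form the algorithm can produce \<open>B (\<phi> k) (\<phi> k) = - 1\<close>.  Subtracting
  \<open>D k n\<close> times \<open>\<phi> k\<close> then doubles the component along \<open>\<phi> k\<close> instead of removing it, so
  orthonormality can only be expected as long as no \<open>B (\<psi> k) (\<psi> k)\<close> is negative.
\<close>

definition orthonormal_upto :: "form \<Rightarrow> (nat \<Rightarrow> real \<Rightarrow> complex) \<Rightarrow> nat \<Rightarrow> bool" where
  "orthonormal_upto B u n \<longleftrightarrow>
     (\<forall>i\<le>n. \<forall>j\<le>n. B (u i) (u j) = (if i = j then 1 else 0))"

end

theory Submission
  imports Defs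
begin

text \<open>
  The modified Gram--Schmidt sweep collapses to
  \<open>\<psi>\<^sub>n\<^sub>+\<^sub>1 = \<phi>\<^sub>n' - (\<Sum>j\<le>n. D\<^sub>j\<^sub>,\<^sub>n \<phi>\<^sub>j)\<close>, which after dividing by \<open>D\<^sub>n\<^sub>+\<^sub>1\<^sub>,\<^sub>n \<noteq> 0\<close> is the
  recurrence (ii).  Read in one direction, (ii) puts \<open>\<phi>\<^sub>n\<^sub>+\<^sub>1\<close> in the Krylov space; read in the other,
  it shows that differentiation maps the span of \<open>\<phi>\<^sub>0,\<dots>,\<phi>\<^sub>n\<close> into that of \<open>\<phi>\<^sub>0,\<dots>,\<phi>\<^sub>n\<^sub>+\<^sub>1\<close>,
  so that the derivatives of \<open>\<phi>\<^sub>0\<close> are recovered inductively.  A spanning family with \<open>n + 1\<close>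
  members of a space of dimension \<open>n + 1\<close> (the seed property) is a basis.  Orthogonality is an
  induction on the sweep.
\<close>

section \<open>Spanning families with as few members as the dimension\<close>

lemma cfun_sum_apply: "(\<Sum>i\<in>A. f i) x = (\<Sum>i\<in>A. (f i x :: complex))"
  by (induction A rule: infinite_finite_induct) auto

text \<open>The \<open>n + 1\<close> independent vectors \<open>v k\<close> force every finite set
  whose span contains them to have at least \<open>n + 1\<close> elements. The family
  \<open>u\<close> therefore can neither repeat a vector nor contain a redundant one.\<close>

lemma basis_upto_if_spans_independent:
  assumes inj: "inj_on v {..n}" and indep: "cfun.independent (v ` {..n})"
    and span: "cfun.span (u ` {..n}) = cfun.span (v ` {..n})"
  shows "basis_upto u n (cfun.span (v ` {..n}))"
proof -
  have bound: "n + 1 \<le> card T" if "finite T" "v ` {..n} \<subseteq> cfun.span T" for T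
    using cfun.independent_span_bound[OF that(1) indep that(2)] card_image[OF inj] by simp
  have gens: "v ` {..n} \<subseteq> cfun.span (u ` {..n})"
    unfolding span by (rule cfun.span_superset)
  have card: "card (u ` {..n}) = n + 1"
    using bound[OF _ gens] card_image_le[of "{..n}" u] by simp
  have "inj_on u {..n}"
    by (rule eq_card_imp_inj_on) (use card in auto)
  moreover have "cfun.independent (u ` {..n})"
  proof
    assume "cfun.dependent (u ` {..n})"
    then obtain w where w: "w \<in> u ` {..n}" "w \<in> cfun.span (u ` {..n} - {w})"
      unfolding cfun.dependent_def by blast
    \<comment> \<open>A redundant \<open>w\<close> could be dropped without shrinking the span,
      which would leave only \<open>n\<close> spanning vectors.\<close>
    have "cfun.span (u ` {..n} - {w}) = cfun.span (u ` {..n})"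
      using cfun.span_redundant[OF w(2)] w(1) by (simp add: insert_absorb)
    then have "n + 1 \<le> card (u ` {..n} - {w})"
      using bound[of "u ` {..n} - {w}"] gens by simp
    then show False
      using w(1) card by simp
  qed
  ultimately show ?thesis
    using span unfolding basis_upto_def by blast
qed

section \<open>Derivatives of the seed function and Krylov spaces\<close>

lemma nth_deriv_on_0 [simp]: "nth_deriv_on a b 0 f = f"
  by (simp add: nth_deriv_on_def)

lemma nth_deriv_on_Suc: "nth_deriv_on a b (Suc n) f = deriv_on a b (nth_deriv_on a b n f)"
  by (simp add: nth_deriv_on_def)

lemma krylov_Suc: "krylov a b (Suc n) f = cfun.span ((\<lambda>k. nth_deriv_on a b k f) ` {..n})"
  by (simp add: krylov_def lessThan_Suc_atMost)

lemma krylov_subset_deriv_span: "krylov a b n f \<subseteq> deriv_span a b f"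
  unfolding krylov_def deriv_span_def by (rule cfun.span_mono) auto

text \<open>The seed property concerns coefficients indexed by the order of the derivative, whereas
  \<open>cfun.independent\<close> concerns a set and does not see repetitions. Hence injectivity is
  stated separately and proved first, to turn sums over the set into sums over orders.\<close>

lemma seed_function_derivs_independent:
  assumes seed: "seed_function a b f"
  shows "inj_on (\<lambda>k. nth_deriv_on a b k f) {..n}"
    and "cfun.independent ((\<lambda>k. nth_deriv_on a b k f) ` {..n})"
proof -
  let ?d = "\<lambda>k. nth_deriv_on a b k f"
  have zero: "c k = 0" if "(\<Sum>k\<le>n. cscale (c k) (?d k)) = 0" "k \<le> n" for c k
  proof (rule ccontr)
    assume "c k \<noteq> 0"
    moreover have "(\<Sum>k\<le>n. c k * ?d k x) = 0" for x
      using fun_cong[OF that(1), of x] by (simp add: cfun_sum_apply cscale_def)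
    ultimately show False
      using seed \<open>k \<le> n\<close> unfolding seed_function_def by blast
  qed
  show inj: "inj_on ?d {..n}"
  proof (rule inj_onI, rule ccontr)
    fix i j assume ij: "i \<in> {..n}" "j \<in> {..n}" "?d i = ?d j" "i \<noteq> j"
    \<comment> \<open>Coinciding derivatives of orders \<open>i\<close> and \<open>j\<close> would
      cancel with coefficients 1 and -1.\<close>
    let ?c = "\<lambda>k. if k = i then 1 else if k = j then - 1 else (0::complex)"
    have "cscale (?c k) (?d k) = (if k = i then ?d i else 0) - (if k = j then ?d j else 0)" for k
      using ij by (auto simp: cscale_def fun_eq_iff)
    then have "(\<Sum>k\<le>n. cscale (?c k) (?d k)) = ?d i - ?d j"
      using ij by (simp only: sum_subtractf) simp
    then show False
      using zero[of ?c i] ij by simp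
  qed
  show "cfun.independent (?d ` {..n})"
    unfolding cfun.independent_explicit_finite_subsets
  proof (intro allI impI ballI)
    fix S u v
    assume S: "S \<subseteq> ?d ` {..n}" "finite S" "(\<Sum>w\<in>S. cscale (u w) w) = 0" and v: "v \<in> S"
    \<comment> \<open>Extending \<open>u\<close> by zero outside \<open>S\<close> makes the relation
      run over all orders up to \<open>n\<close>.\<close>
    let ?u = "\<lambda>w. if w \<in> S then u w else 0"
    have "(\<Sum>k\<le>n. cscale (?u (?d k)) (?d k)) = (\<Sum>w\<in>?d ` {..n}. cscale (?u w) w)"
      by (simp add: sum.reindex[OF inj])
    also have "\<dots> = (\<Sum>w\<in>S. cscale (?u w) w)"
      by (rule sum.mono_neutral_right) (use S in \<open>auto simp: cscale_def zero_fun_def\<close>)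
    also have "\<dots> = 0"
      using S(3) by simp
    finally have "(\<Sum>k\<le>n. cscale (?u (?d k)) (?d k)) = 0" .
    moreover obtain k where "k \<le> n" "v = ?d k"
      using S(1) v by auto
    ultimately show "u v = 0"
      using zero[of "\<lambda>k. ?u (?d k)" k] v by simp
  qed
qed

text \<open>The two conclusions share one induction: additivity of the derivative at
  \<open>cscale c s + g\<close> needs \<open>g\<close> differentiable. Outside the interval
  linearity is trivial, because \<open>deriv_on\<close> is 0 there.\<close>

lemma deriv_on_span:
  assumes S: "\<And>s x. s \<in> S \<Longrightarrow> x \<in> einterval a b \<Longrightarrow> s differentiable at x"
    and f: "f \<in> cfun.span S"
  shows "(\<forall>x\<in>einterval a b. f differentiable at x) \<and>
    deriv_on a b f \<in> cfun.span (deriv_on a b ` S)"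
  using f
proof (induction rule: cfun.span_induct_alt)
  case base
  have "deriv_on a b 0 = 0"
    by (auto simp: deriv_on_def zero_fun_def)
  moreover have "(0 :: real \<Rightarrow> complex) differentiable at x" for x
    by (simp add: zero_fun_def)
  ultimately show ?case
    using cfun.span_zero by metis
next
  case (step c s g)
  have sum: "cscale c s + g = (\<lambda>x. c * s x + g x)"
    by (auto simp: cscale_def fun_eq_iff)
  have der: "((cscale c s + g) has_vector_derivative
      c * vector_derivative s (at x) + vector_derivative g (at x)) (at x)"
    if "x \<in> einterval a b" for x
    unfolding sum using S[OF step(1) that] step(2) that
    by (intro has_vector_derivative_add has_vector_derivative_mult_right)
       (auto simp flip: vector_derivative_works)
  have "deriv_on a b (cscale c s + g) = cscale c (deriv_on a b s) + deriv_on a b g"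
    using vector_derivative_at[OF der] by (auto simp: deriv_on_def cscale_def fun_eq_iff)
  then have "deriv_on a b (cscale c s + g) \<in> cfun.span (deriv_on a b ` S)"
    using step by (metis cfun.span_add cfun.span_scale cfun.span_base imageI)
  then show ?case
    using der differentiableI_vector by blast
qed

lemma smooth_krylov_deriv:
  assumes "smooth_on_interval a b f" and g: "g \<in> krylov a b n f"
  shows "x \<in> einterval a b \<Longrightarrow> g differentiable at x"
    and "deriv_on a b g \<in> krylov a b (Suc n) f"
proof -
  let ?S = "(\<lambda>k. nth_deriv_on a b k f) ` {..<n}"
  have *: "(\<forall>x\<in>einterval a b. g differentiable at x) \<and>
      deriv_on a b g \<in> cfun.span (deriv_on a b ` ?S)"
    using assms by (intro deriv_on_span) (auto simp: smooth_on_interval_def krylov_def)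
  then show "x \<in> einterval a b \<Longrightarrow> g differentiable at x"
    by blast
  have "deriv_on a b ` ?S \<subseteq> (\<lambda>k. nth_deriv_on a b k f) ` {..<Suc n}"
    by (auto simp flip: nth_deriv_on_Suc)
  then show "deriv_on a b g \<in> krylov a b (Suc n) f"
    using * cfun.span_mono unfolding krylov_def by blast
qed

section \<open>The recurrence and the span of the Arnoldi functions\<close>

lemma arnoldi_step_eq:
  "k \<le> Suc n \<Longrightarrow> arnoldi_step a b B f n k =
    deriv_on a b (arnoldi_phi a b B f n)
      - (\<Sum>j<k. cscale (arnoldi_D a b B f j n) (arnoldi_phi a b B f j))"
  by (induction k) (auto simp: Let_def arnoldi_D_def diff_diff_eq)

lemma arnoldi_phi_Suc:
  "arnoldi_phi a b B f (Suc n) =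
    cscale (inverse (arnoldi_D a b B f (Suc n) n)) (arnoldi_psi a b B f (Suc n))"
  by (simp add: Let_def arnoldi_D_def arnoldi_psi_def)

lemma arnoldi_recurrence:
  assumes "arnoldi_D a b B f (Suc n) n \<noteq> 0"
  shows "deriv_on a b (arnoldi_phi a b B f n) =
    (\<Sum>j\<le>Suc n. cscale (arnoldi_D a b B f j n) (arnoldi_phi a b B f j))"
proof -
  \<comment> \<open>The term with index \<open>Suc n\<close> undoes the normalisation and returns
    the fully reduced vector, so moving the subtracted terms back gives the derivative.\<close>
  have "cscale (arnoldi_D a b B f (Suc n) n) (arnoldi_phi a b B f (Suc n)) =
      arnoldi_step a b B f n (Suc n)"
    unfolding arnoldi_phi_Suc using assms by (simp add: arnoldi_psi_def)
  then show ?thesis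
    by (simp add: arnoldi_step_eq lessThan_Suc_atMost del: arnoldi_step.simps arnoldi_phi.simps)
qed

lemma arnoldi_phi_in_krylov:
  assumes smooth: "smooth_on_interval a b f"
  shows "arnoldi_phi a b B f n \<in> krylov a b (Suc n) f"
\<comment> \<open>Strong induction, since the sweep subtracts multiples of all earlier
  \<phi>'s.\<close>
proof (induction n rule: less_induct)
  case (less n)
  show ?case
  proof (cases n)
    case 0
    then show ?thesis
      by (auto simp: krylov_Suc intro!: cfun.span_base)
  next
    case (Suc m)
    have phi: "arnoldi_phi a b B f j \<in> krylov a b (Suc n) f" if "j < Suc m" for j
    proof -
      have "krylov a b (Suc j) f \<subseteq> krylov a b (Suc n) f"
        unfolding krylov_def by (intro cfun.span_mono image_mono) (use that Suc in auto)
      then show ?thesis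
        using less[of j] that Suc by auto
    qed
    have "deriv_on a b (arnoldi_phi a b B f m) \<in> krylov a b (Suc n) f"
      using smooth_krylov_deriv(2)[OF smooth less[of m]] Suc by simp
    then show ?thesis
      using phi unfolding Suc arnoldi_phi_Suc arnoldi_psi_def diff_Suc_1
        arnoldi_step_eq[OF order_refl] krylov_def
      by (intro cfun.span_scale cfun.span_diff cfun.span_sum) auto
  qed
qed

lemma nth_deriv_on_in_arnoldi_span:
  assumes smooth: "smooth_on_interval a b f"
    and D: "\<And>n. arnoldi_D a b B f (Suc n) n \<noteq> 0"
  shows "nth_deriv_on a b n f \<in> cfun.span (arnoldi_phi a b B f ` {..n})"
proof (induction n)
  case 0
  show ?case
    by (auto intro!: cfun.span_base)
next
  case (Suc n)
  let ?\<phi> = "arnoldi_phi a b B f"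
  have "deriv_on a b (?\<phi> k) \<in> cfun.span (?\<phi> ` {..Suc n})" if "k \<le> n" for k
    unfolding arnoldi_recurrence[OF D]
    by (intro cfun.span_sum cfun.span_scale cfun.span_base) (use that in auto)
  then have "cfun.span (deriv_on a b ` ?\<phi> ` {..n}) \<subseteq> cfun.span (?\<phi> ` {..Suc n})"
    by (intro cfun.span_minimal) auto
  \<comment> \<open>Differentiability of the generators comes from their membership in Krylov
    spaces, so this inclusion builds on the opposite one.\<close>
  moreover have "deriv_on a b (nth_deriv_on a b n f) \<in> cfun.span (deriv_on a b ` ?\<phi> ` {..n})"
    using deriv_on_span[OF _ Suc, of a b]
      smooth_krylov_deriv(1)[OF smooth arnoldi_phi_in_krylov[OF smooth]] by blast
  ultimately show ?case
    unfolding nth_deriv_on_Suc by blast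
qed

lemma arnoldi_span:
  assumes smooth: "smooth_on_interval a b f"
    and D: "\<And>n. arnoldi_D a b B f (Suc n) n \<noteq> 0"
  shows "cfun.span (arnoldi_phi a b B f ` {..n}) = krylov a b (Suc n) f"
proof (rule cfun.span_eq[THEN iffD2, of _ "(\<lambda>k. nth_deriv_on a b k f) ` {..n}", folded krylov_Suc],
    intro conjI subsetI)
  fix g assume "g \<in> arnoldi_phi a b B f ` {..n}"
  then obtain k where k: "k \<le> n" "g = arnoldi_phi a b B f k"
    by auto
  have "krylov a b (Suc k) f \<subseteq> krylov a b (Suc n) f"
    unfolding krylov_def by (intro cfun.span_mono image_mono) (use k in auto)
  then show "g \<in> krylov a b (Suc n) f"
    using arnoldi_phi_in_krylov[OF smooth] k by blast
next
  fix g assume "g \<in> (\<lambda>k. nth_deriv_on a b k f) ` {..n}"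
  then obtain k where k: "k \<le> n" "g = nth_deriv_on a b k f"
    by auto
  have "cfun.span (arnoldi_phi a b B f ` {..k}) \<subseteq> cfun.span (arnoldi_phi a b B f ` {..n})"
    by (intro cfun.span_mono image_mono) (use k in auto)
  then show "g \<in> cfun.span (arnoldi_phi a b B f ` {..n})"
    using nth_deriv_on_in_arnoldi_span[OF smooth D] k by blast
qed

section \<open>Orthonormality\<close>

text \<open>\<open>B\<close> is assumed to be Hermitian sesquilinear only on
  \<open>deriv_span\<close>, so the intermediate vectors of the sweep must be shown to lie
  there.\<close>

lemma arnoldi_step_in_deriv_span:
  assumes smooth: "smooth_on_interval a b f" and "k \<le> Suc n"
  shows "arnoldi_step a b B f n k \<in> deriv_span a b f"
proof -
  have "arnoldi_phi a b B f j \<in> deriv_span a b f" for j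
    using arnoldi_phi_in_krylov[OF smooth] krylov_subset_deriv_span by blast
  moreover have "deriv_on a b (arnoldi_phi a b B f n) \<in> deriv_span a b f"
    using smooth_krylov_deriv(2)[OF smooth arnoldi_phi_in_krylov[OF smooth]]
      krylov_subset_deriv_span by blast
  ultimately show ?thesis
    unfolding arnoldi_step_eq[OF assms(2)] deriv_span_def
    by (intro cfun.span_diff cfun.span_sum cfun.span_scale)
qed

lemma hermitian_form_on_scale:
  assumes "hermitian_form_on V B" "p \<in> V" "q \<in> V"
  shows "B (cscale c p) q = c * B p q" and "B p (cscale c q) = cnj c * B p q"
  using assms unfolding hermitian_form_on_def by blast+

lemma hermitian_form_on_diff_scale_left:
  assumes "hermitian_form_on (deriv_span a b f) B"
    and "p \<in> deriv_span a b f" "q \<in> deriv_span a b f" "r \<in> deriv_span a b f"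
  shows "B (p - cscale c q) r = B p r - c * B q r"
proof -
  have eq: "p - cscale c q = p + cscale (- c) q"
    by (auto simp: cscale_def fun_eq_iff)
  have "cscale (- c) q \<in> deriv_span a b f"
    using assms(3) unfolding deriv_span_def by (rule cfun.span_scale)
  then have "B (p - cscale c q) r = B p r + B (cscale (- c) q) r"
    using assms unfolding eq hermitian_form_on_def by blast
  then show ?thesis
    unfolding hermitian_form_on_scale(1)[OF assms(1,3,4)] by simp
qed

text \<open>Subtracting along \<open>arnoldi_phi k\<close> removes that component because
  \<open>arnoldi_phi k\<close> has square 1 under \<open>B\<close>, and it leaves the zeros already
  obtained intact because \<open>arnoldi_phi k\<close> is orthogonal to the earlier
  functions.\<close>

lemma arnoldi_step_orthogonal:
  assumes smooth: "smooth_on_interval a b f"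
    and B: "hermitian_form_on (deriv_span a b f) B"
    and on: "orthonormal_upto B (arnoldi_phi a b B f) n"
  shows "k \<le> Suc n \<Longrightarrow> i < k \<Longrightarrow> B (arnoldi_step a b B f n k) (arnoldi_phi a b B f i) = 0"
proof (induction k)
  case (Suc k)
  have phi: "arnoldi_phi a b B f j \<in> deriv_span a b f" for j
    using arnoldi_phi_in_krylov[OF smooth] krylov_subset_deriv_span by blast
  have step: "arnoldi_step a b B f n k \<in> deriv_span a b f"
    using arnoldi_step_in_deriv_span[OF smooth] Suc.prems by simp
  have "B (arnoldi_phi a b B f k) (arnoldi_phi a b B f i) = (if k = i then 1 else 0)"
    using on Suc.prems by (simp add: orthonormal_upto_def del: arnoldi_phi.simps)
  moreover have step_Suc: "arnoldi_step a b B f n (Suc k) = arnoldi_step a b B f n k -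
      cscale (B (arnoldi_step a b B f n k) (arnoldi_phi a b B f k)) (arnoldi_phi a b B f k)"
    using Suc.prems by (simp add: Let_def)
  ultimately show ?case
    unfolding step_Suc hermitian_form_on_diff_scale_left[OF B step phi phi]
    using Suc by (cases "i = k") auto
qed simp

text \<open>The sweep makes the new function orthogonal to the old ones. The sign condition makes
  its square 1: normalising by the root of the modulus would turn a negative square into -1.\<close>

lemma arnoldi_orthonormal:
  assumes smooth: "smooth_on_interval a b f"
    and B: "hermitian_form_on (deriv_span a b f) B"
    and B0: "B f f = 1"
    and D: "\<And>n. arnoldi_D a b B f (Suc n) n \<noteq> 0"
  shows "(\<And>k. 1 \<le> k \<Longrightarrow> k \<le> n \<Longrightarrow> B (arnoldi_psi a b B f k) (arnoldi_psi a b B f k) \<ge> 0) \<Longrightarrow>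
    orthonormal_upto B (arnoldi_phi a b B f) n"
proof (induction n)
  case 0
  then show ?case
    using B0 by (simp add: orthonormal_upto_def)
next
  case (Suc n)
  let ?\<phi> = "arnoldi_phi a b B f"
  let ?p = "arnoldi_psi a b B f (Suc n)"
  let ?c = "arnoldi_D a b B f (Suc n) n"
  have on: "orthonormal_upto B ?\<phi> n"
    using Suc by simp
  have phi: "?\<phi> j \<in> deriv_span a b f" for j
    using arnoldi_phi_in_krylov[OF smooth] krylov_subset_deriv_span by blast
  have p: "?p \<in> deriv_span a b f"
    using arnoldi_step_in_deriv_span[OF smooth] by (simp add: arnoldi_psi_def del: arnoldi_step.simps)
  have c: "?c = of_real (sqrt (cmod (B ?p ?p)))"
    by (simp add: arnoldi_D_def)
  have orth: "B (?\<phi> (Suc n)) (?\<phi> i) = 0" if "i \<le> n" for i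
    unfolding arnoldi_phi_Suc hermitian_form_on_scale(1)[OF B p phi]
    using arnoldi_step_orthogonal[OF smooth B on, of "Suc n" i] that
    by (simp add: arnoldi_psi_def del: arnoldi_step.simps)
  then have orth': "B (?\<phi> i) (?\<phi> (Suc n)) = 0" if "i \<le> n" for i
    using B phi that unfolding hermitian_form_on_def by (metis complex_cnj_zero)
  have "B ?p ?p \<ge> 0"
    using Suc.prems by simp
  \<comment> \<open>The order on complex numbers compares only numbers with equal imaginary part, so
    being nonnegative includes being real.\<close>
  then have "B ?p ?p = of_real (cmod (B ?p ?p))"
    by (auto simp: less_eq_complex_def complex_eq_iff cmod_def)
  then have square: "B ?p ?p = ?c * ?c"
    unfolding c by (metis abs_norm_cancel of_real_mult real_sqrt_mult_self)
  have "B (?\<phi> (Suc n)) (?\<phi> (Suc n)) = inverse ?c * (cnj (inverse ?c) * B ?p ?p)"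
    using hermitian_form_on_scale(1)[OF B p phi[of "Suc n"]] hermitian_form_on_scale(2)[OF B p p]
    unfolding arnoldi_phi_Suc by simp
  \<comment> \<open>The normalising factor is real, so conjugate-linearity in the second argument
    yields the same factor again.\<close>
  also have "cnj (inverse ?c) = inverse ?c"
    by (simp add: c)
  also have "inverse ?c * (inverse ?c * B ?p ?p) = 1"
    using D[of n] unfolding square by (simp add: field_simps)
  finally show ?case
    using on orth orth' unfolding orthonormal_upto_def
    by (auto simp: le_Suc_eq simp del: arnoldi_phi.simps)
qed

theorem theorem10:
  fixes a b :: ereal
    and \<phi>0 :: "real \<Rightarrow> complex"
    and B :: "(real \<Rightarrow> complex) \<Rightarrow> (real \<Rightarrow> complex) \<Rightarrow> complex"
  defines "\<phi> \<equiv> arnoldi_phi a b B \<phi>0"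
    and "\<psi> \<equiv> arnoldi_psi a b B \<phi>0"
    and "D \<equiv> arnoldi_D a b B \<phi>0"
  assumes "a < b"
    and "seed_function a b \<phi>0"
    and "hermitian_form_on (deriv_span a b \<phi>0) B"
    and "B \<phi>0 \<phi>0 = 1"
    and "\<And>n. D (n + 1) n > 0"
  shows "upper_hessenberg D \<and>
    (\<forall>n\<ge>1.
       basis_upto \<phi> n (krylov a b (n + 1) \<phi>0) \<and>
       ((\<forall>k\<in>{1..n}. B (\<psi> k) (\<psi> k) \<ge> 0) \<longrightarrow> orthonormal_upto B \<phi> n) \<and>
       (\<forall>x\<in>einterval a b.
          (\<phi> (n - 1) has_vector_derivative (\<Sum>k\<le>n. D k (n - 1) * \<phi> k x)) (at x)))"
proof (intro conjI allI impI ballI)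
  have smooth: "smooth_on_interval a b \<phi>0"
    using \<open>seed_function a b \<phi>0\<close> by (simp add: seed_function_def)
  have D: "arnoldi_D a b B \<phi>0 (Suc n) n \<noteq> 0" for n
    using assms(8)[of n] unfolding D_def by (metis Suc_eq_plus1 less_irrefl)
  show "upper_hessenberg D"
    by (simp add: upper_hessenberg_def D_def arnoldi_D_def)
  fix n :: nat assume n: "n \<ge> 1"
  show "basis_upto \<phi> n (krylov a b (n + 1) \<phi>0)"
    using basis_upto_if_spans_independent[OF
        seed_function_derivs_independent[OF \<open>seed_function a b \<phi>0\<close>]] arnoldi_span[OF smooth D]
    by (simp add: \<phi>_def krylov_Suc)
  show "orthonormal_upto B \<phi> n" if "\<forall>k\<in>{1..n}. B (\<psi> k) (\<psi> k) \<ge> 0"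
    unfolding \<phi>_def
    by (rule arnoldi_orthonormal[OF smooth assms(6,7) D]) (use that in \<open>auto simp: \<psi>_def\<close>)
  fix x assume x: "x \<in> einterval a b"
  obtain m where m: "n = Suc m"
    using n by (cases n) auto
  have "\<phi> m differentiable at x"
    using smooth_krylov_deriv(1)[OF smooth arnoldi_phi_in_krylov[OF smooth] x] by (simp add: \<phi>_def)
  \<comment> \<open>The recurrence is an equation between total functions. At a point of the
    interval its left side is the true derivative.\<close>
  moreover have "vector_derivative (\<phi> m) (at x) = (\<Sum>k\<le>n. D k m * \<phi> k x)"
    using fun_cong[OF arnoldi_recurrence[OF D], of m x] x
    by (simp add: deriv_on_def cfun_sum_apply cscale_def \<phi>_def D_def m
        del: arnoldi_phi.simps sum.atMost_Suc)
  ultimately show "(\<phi> (n - 1) has_vector_derivative (\<Sum>k\<le>n. D k (n - 1) * \<phi> k x)) (at x)"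
    using m by (simp add: vector_derivative_works)
qed

end
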